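(* Let $1\le p<\infty$ and let $X$ be a constant~$1$ $p$-convex generalized function space. The following are equivalent: (1) $X$ has the $p$-Daugavet property. (2) For every $\varepsilon>0$, every $g\in S_X$ and every $g^*\in S_{X^*}$ there is an element $h\in S(g^*,\varepsilon)$ such that $$\bigl\|\,|g^p+h^p|^{1/p}\bigr\|^p\ge 2-2\varepsilon.$$
   Context: All Banach spaces are real; $B_X$ and $S_X$ are the closed unit ball and unit sphere of $X$, and $X^*$ is the dual space. For $x^*\in B_{X^*}$ and $\varepsilon>0$, the slice is $S(x^*,\varepsilon)=\{x\in B_X:\langle x,x^*\rangle\ge1-\varepsilon\}$. Let $1\le p<\infty$. Generalized function space (g.f.s.): let $\Delta$ be a set and $\{(A_\delta,\Sigma_\delta,\mu_\delta):\delta\in\Delta\}$ a family of measure spaces, and let $L^0(A_\delta,\mu_\delta)$ be the space of classes of $\mu_\delta$-a.e. equal real measurable functions. For $f\in\prod_{\delta\in\Delta}L^0(A_\delta,\mu_\delta)$ put $|f|(\delta)=|f(\delta)|$. A g.f.s. is a Banach space $X$ that is a linear subspace of such a product, with $|f|\in X$ whenever $f\in X$, and whose norm is a lattice norm for the order inherited from the product ($|f|\le|g|$ implies $\|f\|\le\|g\|$). Signed powers: for $f$ in the product, $f^p$ denotes the pointwise signed power $f^p(\delta)=\operatorname{sign}\{f(\delta)\}\,|f(\delta)|^p$ (this need not equal $|f|^p$, even for even integers $p$), and $(\cdot)^{1/p}$ denotes the inverse operation, i.e. $g^{1/p}=\operatorname{sign}\{g\}|g|^{1/p}$ pointwise.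 A g.f.s. $X$ is constant~$1$ $p$-convex if for every finite family $x_1,\dots,x_n\in X$ the function $(\sum_{i=1}^n x_i^p)^{1/p}$ belongs to $X$ and $\|(\sum_{i=1}^n|x_i|^p)^{1/p}\|\le(\sum_{i=1}^n\|x_i\|^p)^{1/p}$. A constant~$1$ $p$-convex g.f.s. $X$ has the $p$-Daugavet property if every rank one continuous linear operator $T: X\to X$ satisfies the $p$-Daugavet equation $\sup_{f\in B_X}\|(f^p+T(f)^p)^{1/p}\|=(1+\|T\|^p)^{1/p}$. *)

theory Defs
  imports "HOL-Analysis.Analysis"
begin

text \<open>
  An element of the product of the spaces of classes of measurable functions
  on \<open>M \<delta>\<close>, \<open>\<delta> \<in> \<Delta>\<close>, is handled through a representative of type
  \<open>'d \<Rightarrow> 'a \<Rightarrow> real\<close>. Equality and order of classes are equality and order almost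
  everywhere in each coordinate from \<open>\<Delta>\<close>; coordinates outside \<open>\<Delta>\<close> are ignored.
\<close>

definition prod_eq ::
    "'d set \<Rightarrow> ('d \<Rightarrow> 'a measure) \<Rightarrow> ('d \<Rightarrow> 'a \<Rightarrow> real) \<Rightarrow> ('d \<Rightarrow> 'a \<Rightarrow> real) \<Rightarrow> bool" where
  "prod_eq \<Delta> M u v \<longleftrightarrow> (\<forall>\<delta>\<in>\<Delta>. AE a in M \<delta>. u \<delta> a = v \<delta> a)"

definition prod_le ::
    "'d set \<Rightarrow> ('d \<Rightarrow> 'a measure) \<Rightarrow> ('d \<Rightarrow> 'a \<Rightarrow> real) \<Rightarrow> ('d \<Rightarrow> 'a \<Rightarrow> real) \<Rightarrow> bool" where
  "prod_le \<Delta> M u v \<longleftrightarrow> (\<forall>\<delta>\<in>\<Delta>. AE a in M \<delta>. u \<delta> a \<le> v \<delta> a)"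

text \<open>
  The space is a Banach space \<open>'x\<close> that is a linear subspace of the product: \<open>rep x\<close>
  is a representative of the family of classes that the vector \<open>x\<close> is, so \<open>rep\<close> is
  linear and injective modulo \<^const>\<open>prod_eq\<close>.
\<close>

locale gfs =
  fixes \<Delta> :: "'d set"
    and M :: "'d \<Rightarrow> 'a measure"
    and rep :: "'x::banach \<Rightarrow> 'd \<Rightarrow> 'a \<Rightarrow> real"
  assumes rep_measurable: "\<And>x \<delta>. \<delta> \<in> \<Delta> \<Longrightarrow> rep x \<delta> \<in> borel_measurable (M \<delta>)"
    and rep_add: "\<And>x y. prod_eq \<Delta> M (rep (x + y)) (\<lambda>\<delta> a. rep x \<delta> a + rep y \<delta> a)"
    and rep_scaleR: "\<And>c x. prod_eq \<Delta> M (rep (c *\<^sub>R x)) (\<lambda>\<delta> a. c * rep x \<delta> a)"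
    and rep_inject: "\<And>x y. prod_eq \<Delta> M (rep x) (rep y) \<Longrightarrow> x = y"
    and abs_closed: "\<And>x. \<exists>y. prod_eq \<Delta> M (rep y) (\<lambda>\<delta> a. \<bar>rep x \<delta> a\<bar>)"
    and lattice_norm: "\<And>x y. prod_le \<Delta> M (\<lambda>\<delta> a. \<bar>rep x \<delta> a\<bar>) (\<lambda>\<delta> a. \<bar>rep y \<delta> a\<bar>)
                         \<Longrightarrow> norm x \<le> norm y"

definition belongs ::
    "'d set \<Rightarrow> ('d \<Rightarrow> 'a measure) \<Rightarrow> ('x::banach \<Rightarrow> 'd \<Rightarrow> 'a \<Rightarrow> real)
      \<Rightarrow> ('d \<Rightarrow> 'a \<Rightarrow> real) \<Rightarrow> bool" where
  "belongs \<Delta> M rep u \<longleftrightarrow> (\<exists>x. prod_eq \<Delta> M (rep x) u)"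

text \<open>The norm of (the class of) \<open>u\<close>; meaningful only if \<open>u\<close> belongs to the space.\<close>

definition gnorm ::
    "'d set \<Rightarrow> ('d \<Rightarrow> 'a measure) \<Rightarrow> ('x::banach \<Rightarrow> 'd \<Rightarrow> 'a \<Rightarrow> real)
      \<Rightarrow> ('d \<Rightarrow> 'a \<Rightarrow> real) \<Rightarrow> real" where
  "gnorm \<Delta> M rep u = norm (THE x. prod_eq \<Delta> M (rep x) u)"

lemma (in gfs) gnorm_eq:
  assumes "prod_eq \<Delta> M (rep x) u"
  shows "gnorm \<Delta> M rep u = norm x"
proof -
  have "y = x" if "prod_eq \<Delta> M (rep y) u" for y
  proof (rule rep_inject)
    show "prod_eq \<Delta> M (rep y) (rep x)"
      unfolding prod_eq_def
    proof
      fix \<delta> assume "\<delta> \<in> \<Delta>"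
      then have "AE a in M \<delta>. rep x \<delta> a = u \<delta> a" "AE a in M \<delta>. rep y \<delta> a = u \<delta> a"
        using assms that by (auto simp: prod_eq_def)
      then show "AE a in M \<delta>. rep y \<delta> a = rep x \<delta> a"
        by eventually_elim simp
    qed
  qed
  with assms have "(THE y. prod_eq \<Delta> M (rep y) u) = x"
    by blast
  then show ?thesis
    by (simp add: gnorm_def)
qed

text \<open>The signed power; its inverse is \<open>spow (1 / p)\<close>.\<close>

definition spow :: "real \<Rightarrow> real \<Rightarrow> real" where
  "spow p t = sgn t * \<bar>t\<bar> powr p"

definition p_convex ::
    "real \<Rightarrow> 'd set \<Rightarrow> ('d \<Rightarrow> 'a measure) \<Rightarrow> ('x::banach \<Rightarrow> 'd \<Rightarrow> 'a \<Rightarrow> real) \<Rightarrow> bool" where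
  "p_convex p \<Delta> M rep \<longleftrightarrow>
    (\<forall>(n::nat) (x :: nat \<Rightarrow> 'x).
      belongs \<Delta> M rep (\<lambda>\<delta> a. spow (1 / p) (\<Sum>i<n. spow p (rep (x i) \<delta> a))) \<and>
      gnorm \<Delta> M rep (\<lambda>\<delta> a. (\<Sum>i<n. \<bar>rep (x i) \<delta> a\<bar> powr p) powr (1 / p))
        \<le> (\<Sum>i<n. norm (x i) powr p) powr (1 / p))"

definition p_Daugavet_equation ::
    "real \<Rightarrow> 'd set \<Rightarrow> ('d \<Rightarrow> 'a measure) \<Rightarrow> ('x::banach \<Rightarrow> 'd \<Rightarrow> 'a \<Rightarrow> real)
      \<Rightarrow> ('x \<Rightarrow>\<^sub>L 'x) \<Rightarrow> bool" where
  "p_Daugavet_equation p \<Delta> M rep T \<longleftrightarrow>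
    (SUP f\<in>cball 0 1.
       gnorm \<Delta> M rep
         (\<lambda>\<delta> a. spow (1 / p) (spow p (rep f \<delta> a) + spow p (rep (blinfun_apply T f) \<delta> a))))
      = (1 + norm T powr p) powr (1 / p)"

definition p_Daugavet_property ::
    "real \<Rightarrow> 'd set \<Rightarrow> ('d \<Rightarrow> 'a measure) \<Rightarrow> ('x::banach \<Rightarrow> 'd \<Rightarrow> 'a \<Rightarrow> real) \<Rightarrow> bool" where
  "p_Daugavet_property p \<Delta> M rep \<longleftrightarrow>
    (\<forall>T :: 'x \<Rightarrow>\<^sub>L 'x. dim (range (blinfun_apply T)) = 1 \<longrightarrow> p_Daugavet_equation p \<Delta> M rep T)"

definition slice :: "('x::banach \<Rightarrow>\<^sub>L real) \<Rightarrow> real \<Rightarrow> 'x set" where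
  "slice \<phi> \<epsilon> = {x \<in> cball 0 1. blinfun_apply \<phi> x \<ge> 1 - \<epsilon>}"

end

theory Submission
  imports Defs
begin

text \<open>
  Write \<open>x \<oplus> y = (x\<^sup>p + y\<^sup>p)\<^sup>1\<^sup>/\<^sup>p\<close>. Since \<open>p\<close>-convexity makes \<open>\<parallel>\<cdot>\<parallel>\<^sup>p\<close> subadditive for
  \<open>\<oplus>\<close>, changing the scalars in \<open>\<parallel>a h \<oplus> b g\<parallel>\<^sup>p\<close> costs at most \<open>\<bar>a\<^sup>p - a'\<^sup>p\<bar> \<parallel>h\<parallel>\<^sup>p + \<bar>b\<^sup>p - b'\<^sup>p\<bar> \<parallel>g\<parallel>\<^sup>p\<close>.
  A rank one operator is \<open>T f = c \<phi>(f) g\<close> with \<open>\<parallel>\<phi>\<parallel> = \<parallel>g\<parallel> = 1\<close> and \<open>c = \<parallel>T\<parallel>\<close>, so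
  \<open>\<parallel>f \<oplus> T f\<parallel>\<^sup>p\<close> can be near \<open>1 + c\<^sup>p\<close> only if \<open>\<bar>\<phi>(f)\<bar>\<close> is near \<open>1\<close>. Both implications then
  follow by comparing \<open>f \<oplus> c \<phi>(f) g\<close> with \<open>f \<oplus> g\<close> scaled by \<open>max 1 c\<close>.
\<close>

section \<open>Signed powers of real numbers\<close>

lemma spow_0 [simp]: "spow p 0 = 0"
  by (simp add: spow_def)

lemma spow_nonneg: "0 \<le> t \<Longrightarrow> spow p t = t powr p"
  by (simp add: spow_def sgn_if)

lemma abs_spow: "\<bar>spow p t\<bar> = \<bar>t\<bar> powr p"
  by (simp add: spow_def abs_mult abs_sgn_eq)

lemma spow_mult: "spow p (c * t) = spow p c * spow p t"
  by (simp add: spow_def sgn_mult abs_mult powr_mult)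

lemma spow_inverse: "p \<noteq> 0 \<Longrightarrow> spow p (spow (1 / p) t) = t"
  by (cases t "0::real" rule: linorder_cases) (simp_all add: spow_def powr_powr sgn_mult abs_mult)

section \<open>Bounded operators of rank one\<close>

text \<open>A basis of the range is a single vector; normalised, it is \<open>g\<close>. The
  coordinate \<open>k\<close> of \<open>T x\<close> along \<open>g\<close> satisfies
  \<open>\<bar>k x\<bar> = norm (T x)\<close>, so \<open>k\<close> is a functional with the norm of
  \<open>T\<close>, and dividing by \<open>norm T\<close> gives \<open>\<phi>\<close>.\<close>

lemma rank_one_blinfunE:
  fixes T :: "'x::real_normed_vector \<Rightarrow>\<^sub>L 'y::real_normed_vector"
  assumes "dim (range (blinfun_apply T)) = 1"
  obtains \<phi> :: "'x \<Rightarrow>\<^sub>L real" and g where "norm \<phi> = 1" "norm g = 1" "norm T > 0"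
    "\<And>x. blinfun_apply T x = (norm T * blinfun_apply \<phi> x) *\<^sub>R g"
proof -
  obtain B where B: "B \<subseteq> range (blinfun_apply T)" "independent B"
      "range (blinfun_apply T) \<subseteq> span B" "card B = 1"
    using basis_exists[of "range (blinfun_apply T)"] assms by metis
  then obtain b where b: "B = {b}"
    by (auto simp: card_1_singleton_iff)
  with B have "b \<noteq> 0"
    using dependent_zero by blast
  define g where "g = b /\<^sub>R norm b"
  have g: "norm g = 1"
    using \<open>b \<noteq> 0\<close> by (simp add: g_def)
  have "\<exists>k. blinfun_apply T x = k *\<^sub>R g" for x
  proof -
    have "blinfun_apply T x \<in> span {b}"
      using B b by blast
    then obtain k where "blinfun_apply T x = k *\<^sub>R b"
      by (auto simp: span_singleton)
    then have "blinfun_apply T x = (k * norm b) *\<^sub>R g"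
      using \<open>b \<noteq> 0\<close> by (simp add: g_def)
    then show ?thesis ..
  qed
  then obtain k where k: "\<And>x. blinfun_apply T x = k x *\<^sub>R g"
    by metis
  \<comment> \<open>\<open>k\<close> is obtained by choice only; cancelling \<open>g\<close>
    transfers linearity from \<open>T\<close> to \<open>k\<close>.\<close>
  have cancel: "s = t" if "s *\<^sub>R g = t *\<^sub>R g" for s t
    using that g by auto
  have bl: "bounded_linear k"
  proof (rule bounded_linear_intro)
    show "k (x + y) = k x + k y" for x y
      by (rule cancel) (simp add: k[symmetric] scaleR_add_left blinfun.add_right)
    show "k (r *\<^sub>R x) = r *\<^sub>R k x" for r x
      by (rule cancel) (simp add: k[symmetric] scaleR_scaleR[symmetric] blinfun.scaleR_right
          del: scaleR_scaleR)
    show "norm (k x) \<le> norm x * norm T" for x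
      using norm_blinfun[of T x] g by (simp add: k mult.commute)
  qed
  have pos: "norm T > 0"
  proof -
    have "b \<in> range (blinfun_apply T)"
      using B b by blast
    with \<open>b \<noteq> 0\<close> have "T \<noteq> 0"
      by auto
    then show ?thesis by simp
  qed
  have nk: "norm (Blinfun k) = norm T"
    using g by (simp add: norm_blinfun.rep_eq bounded_linear_Blinfun_apply bl k onorm_def)
  show thesis
  proof
    show "norm (Blinfun k /\<^sub>R norm T) = 1"
      using pos nk by simp
    show "blinfun_apply T x = (norm T * blinfun_apply (Blinfun k /\<^sub>R norm T) x) *\<^sub>R g" for x
      using pos by (simp add: k scaleR_blinfun.rep_eq bounded_linear_Blinfun_apply bl)
  qed (use g pos in auto)
qed

lemma rank_one_blinfun_exists:
  fixes \<phi> :: "'x::real_normed_vector \<Rightarrow>\<^sub>L real" and g :: "'y::real_normed_vector"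
  assumes "\<phi> \<noteq> 0" "norm g = 1"
  obtains T where "\<And>x. blinfun_apply T x = blinfun_apply \<phi> x *\<^sub>R g" "norm T = norm \<phi>"
    "dim (range (blinfun_apply T)) = 1"
proof -
  define T where "T = Blinfun (\<lambda>x. blinfun_apply \<phi> x *\<^sub>R g)"
  have bl: "bounded_linear (\<lambda>x. blinfun_apply \<phi> x *\<^sub>R g)"
    by (intro bounded_linear_intros)
  have T: "blinfun_apply T x = blinfun_apply \<phi> x *\<^sub>R g" for x
    by (simp add: T_def bounded_linear_Blinfun_apply bl)
  have "norm T = norm \<phi>"
    using assms by (simp add: norm_blinfun.rep_eq T onorm_def)
  obtain x where x: "blinfun_apply \<phi> x \<noteq> 0"
    using assms(1) by (metis blinfun_eqI zero_blinfun.rep_eq)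
  have "g \<in> range (blinfun_apply T)"
  proof
    show "g = blinfun_apply T (x /\<^sub>R blinfun_apply \<phi> x)"
      using x by (simp add: T blinfun.scaleR_right)
  qed simp
  moreover have "range (blinfun_apply T) \<subseteq> span {g}"
    by (auto simp: T span_singleton)
  moreover have "independent {g}"
    using assms by auto
  ultimately have "dim (range (blinfun_apply T)) = 1"
    using dim_unique[of "{g}" "range (blinfun_apply T)" 1] by simp
  with T \<open>norm T = norm \<phi>\<close> show thesis
    by (rule that)
qed

section \<open>Norm estimates from p-convexity\<close>

locale p_convex_gfs = gfs \<Delta> M rep
  for \<Delta> :: "'d set" and M :: "'d \<Rightarrow> 'a measure" and rep :: "'x::banach \<Rightarrow> 'd \<Rightarrow> 'a \<Rightarrow> real" +
  fixes p :: real
  assumes p_ge_1: "1 \<le> p"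
    and p_convex: "p_convex p \<Delta> M rep"
begin

lemma spow_sum_belongs:
  "\<exists>z. prod_eq \<Delta> M (rep z) (\<lambda>\<delta> a. spow (1 / p) (\<Sum>i<n. spow p (rep (x i) \<delta> a)))"
  for x :: "nat \<Rightarrow> 'x"
  using p_convex by (simp add: p_convex_def belongs_def)

text \<open>Reduces norm estimates to almost everywhere inequalities between p-th powers. Once the
  \<open>x i\<close> are replaced by their moduli, the signed sum becomes the function in the
  p-convexity inequality, and this function dominates \<open>\<bar>u\<bar>\<close>, so the lattice
  norm applies.\<close>

lemma norm_powr_le_sum:
  fixes x :: "nat \<Rightarrow> 'x"
  assumes "\<And>\<delta>. \<delta> \<in> \<Delta> \<Longrightarrow>
    AE a in M \<delta>. \<bar>spow p (rep u \<delta> a)\<bar> \<le> (\<Sum>i<n. \<bar>spow p (rep (x i) \<delta> a)\<bar>)"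
  shows "norm u powr p \<le> (\<Sum>i<n. norm (x i) powr p)"
proof -
  let ?s = "\<lambda>\<delta> a. \<Sum>i<n. \<bar>rep (x i) \<delta> a\<bar> powr p"
  have "\<forall>i. \<exists>y. prod_eq \<Delta> M (rep y) (\<lambda>\<delta> a. \<bar>rep (x i) \<delta> a\<bar>)"
    using abs_closed by blast
  then obtain y where y: "\<And>i. prod_eq \<Delta> M (rep (y i)) (\<lambda>\<delta> a. \<bar>rep (x i) \<delta> a\<bar>)"
    by metis
  obtain z where z: "prod_eq \<Delta> M (rep z) (\<lambda>\<delta> a. spow (1 / p) (\<Sum>i<n. spow p (rep (y i) \<delta> a)))"
    using spow_sum_belongs[where x = y] by metis
  have z': "prod_eq \<Delta> M (rep z) (\<lambda>\<delta> a. ?s \<delta> a powr (1 / p))"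
    unfolding prod_eq_def
  proof
    fix \<delta> assume d: "\<delta> \<in> \<Delta>"
    \<comment> \<open>Countably many exceptional null sets are merged into one.\<close>
    have "AE a in M \<delta>. \<forall>i. rep (y i) \<delta> a = \<bar>rep (x i) \<delta> a\<bar>"
      using y d by (auto simp: prod_eq_def AE_all_countable)
    moreover have "AE a in M \<delta>. rep z \<delta> a = spow (1 / p) (\<Sum>i<n. spow p (rep (y i) \<delta> a))"
      using z d by (auto simp: prod_eq_def)
    ultimately show "AE a in M \<delta>. rep z \<delta> a = ?s \<delta> a powr (1 / p)"
      by eventually_elim (simp add: spow_nonneg sum_nonneg)
  qed
  have "norm u \<le> norm z"
  proof (rule lattice_norm, unfold prod_le_def, rule ballI)
    fix \<delta> assume d: "\<delta> \<in> \<Delta>"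
    then have "AE a in M \<delta>. rep z \<delta> a = ?s \<delta> a powr (1 / p)"
      using z' by (auto simp: prod_eq_def)
    with assms[OF d] show "AE a in M \<delta>. \<bar>rep u \<delta> a\<bar> \<le> \<bar>rep z \<delta> a\<bar>"
    proof eventually_elim
      case (elim a)
      have "\<bar>rep u \<delta> a\<bar> = (\<bar>rep u \<delta> a\<bar> powr p) powr (1 / p)"
        using p_ge_1 by (simp add: powr_powr)
      also have "\<dots> \<le> ?s \<delta> a powr (1 / p)"
        using elim p_ge_1 by (intro powr_mono2) (auto simp: abs_spow)
      finally show ?case
        using elim by simp
    qed
  qed
  also have "norm z \<le> (\<Sum>i<n. norm (x i) powr p) powr (1 / p)"
    unfolding gnorm_eq[OF z', symmetric] using p_convex by (simp add: p_convex_def)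
  finally have "norm u powr p \<le> ((\<Sum>i<n. norm (x i) powr p) powr (1 / p)) powr p"
    using p_ge_1 by (intro powr_mono2) auto
  then show ?thesis
    using p_ge_1 by (simp add: powr_powr sum_nonneg)
qed

section \<open>The p-sum of two vectors\<close>

text \<open>A vector of the space rather than a function, so that \<open>norm\<close> can replace
  \<open>gnorm\<close>. It exists by p-convexity and is unique by \<open>rep_inject\<close>, so the
  choice is harmless.\<close>

definition psum :: "'x \<Rightarrow> 'x \<Rightarrow> 'x" where
  "psum x y = (SOME z. prod_eq \<Delta> M (rep z)
     (\<lambda>\<delta> a. spow (1 / p) (spow p (rep x \<delta> a) + spow p (rep y \<delta> a))))"

lemma rep_psum:
  "prod_eq \<Delta> M (rep (psum x y)) (\<lambda>\<delta> a. spow (1 / p) (spow p (rep x \<delta> a) + spow p (rep y \<delta> a)))"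
proof -
  let ?x = "\<lambda>i. if i = (0::nat) then x else y"
  show ?thesis
    unfolding psum_def
    by (rule someI_ex) (use spow_sum_belongs[of ?x 2] in \<open>simp add: numeral_2_eq_2\<close>)
qed

lemma AE_spow_psum:
  assumes "\<delta> \<in> \<Delta>"
  shows "AE a in M \<delta>. spow p (rep (psum x y) \<delta> a) = spow p (rep x \<delta> a) + spow p (rep y \<delta> a)"
  using bspec[OF rep_psum[of x y, unfolded prod_eq_def] assms]
  by eventually_elim (use p_ge_1 in \<open>simp add: spow_inverse\<close>)

lemma AE_spow_scaleR:
  assumes "\<delta> \<in> \<Delta>"
  shows "AE a in M \<delta>. spow p (rep (c *\<^sub>R x) \<delta> a) = spow p c * spow p (rep x \<delta> a)"
proof -
  have "AE a in M \<delta>. rep (c *\<^sub>R x) \<delta> a = c * rep x \<delta> a"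
    using rep_scaleR assms by (auto simp: prod_eq_def)
  then show ?thesis
    by eventually_elim (simp add: spow_mult)
qed

lemma gnorm_psum:
  "gnorm \<Delta> M rep (\<lambda>\<delta> a. spow (1 / p) (spow p (rep x \<delta> a) + spow p (rep y \<delta> a))) = norm (psum x y)"
  by (rule gnorm_eq[OF rep_psum])

text \<open>A lattice norm does not distinguish a function from its modulus. This brings the slice
  condition into the same form as the Daugavet equation.\<close>

lemma gnorm_abs_psum:
  "gnorm \<Delta> M rep (\<lambda>\<delta> a. \<bar>spow p (rep x \<delta> a) + spow p (rep y \<delta> a)\<bar> powr (1 / p)) = norm (psum x y)"
proof -
  obtain z where z: "prod_eq \<Delta> M (rep z) (\<lambda>\<delta> a. \<bar>rep (psum x y) \<delta> a\<bar>)"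
    using abs_closed by blast
  have "AE a in M \<delta>. rep z \<delta> a = \<bar>spow p (rep x \<delta> a) + spow p (rep y \<delta> a)\<bar> powr (1 / p)"
    if "\<delta> \<in> \<Delta>" for \<delta>
  proof -
    have "AE a in M \<delta>. rep z \<delta> a = \<bar>rep (psum x y) \<delta> a\<bar>"
      using z that by (auto simp: prod_eq_def)
    moreover have "AE a in M \<delta>.
        rep (psum x y) \<delta> a = spow (1 / p) (spow p (rep x \<delta> a) + spow p (rep y \<delta> a))"
      using rep_psum that by (auto simp: prod_eq_def)
    ultimately show ?thesis
      by eventually_elim (simp add: abs_spow)
  qed
  then have "gnorm \<Delta> M rep
      (\<lambda>\<delta> a. \<bar>spow p (rep x \<delta> a) + spow p (rep y \<delta> a)\<bar> powr (1 / p)) = norm z"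
    by (intro gnorm_eq) (simp add: prod_eq_def)
  moreover have "norm z = norm (psum x y)"
  proof -
    have eq: "AE a in M \<delta>. \<bar>rep z \<delta> a\<bar> = \<bar>rep (psum x y) \<delta> a\<bar>" if "\<delta> \<in> \<Delta>" for \<delta>
      using bspec[OF z[unfolded prod_eq_def] that] by eventually_elim simp
    have "prod_le \<Delta> M (\<lambda>\<delta> a. \<bar>rep z \<delta> a\<bar>) (\<lambda>\<delta> a. \<bar>rep (psum x y) \<delta> a\<bar>)"
      unfolding prod_le_def by (rule ballI, rule eventually_mono[OF eq]) auto
    moreover have "prod_le \<Delta> M (\<lambda>\<delta> a. \<bar>rep (psum x y) \<delta> a\<bar>) (\<lambda>\<delta> a. \<bar>rep z \<delta> a\<bar>)"
      unfolding prod_le_def by (rule ballI, rule eventually_mono[OF eq]) auto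
    ultimately show ?thesis
      by (intro antisym lattice_norm)
  qed
  ultimately show ?thesis by simp
qed

lemma norm_psum_le: "norm (psum x y) powr p \<le> norm x powr p + norm y powr p"
proof -
  let ?x = "\<lambda>i. if i = (0::nat) then x else y"
  have "norm (psum x y) powr p \<le> (\<Sum>i<2. norm (?x i) powr p)"
  proof (rule norm_powr_le_sum)
    fix \<delta> assume "\<delta> \<in> \<Delta>"
    from AE_spow_psum[OF this, of x y]
    show "AE a in M \<delta>. \<bar>spow p (rep (psum x y) \<delta> a)\<bar> \<le> (\<Sum>i<2. \<bar>spow p (rep (?x i) \<delta> a)\<bar>)"
      by eventually_elim (simp add: numeral_2_eq_2)
  qed
  then show ?thesis by (simp add: numeral_2_eq_2)
qed

text \<open>Signed powers are multiplicative, so \<open>psum\<close> is homogeneous almost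
  everywhere, also for negative \<open>c\<close>; \<open>norm_powr_le_sum\<close> is used with one
  summand.\<close>

lemma norm_psum_scaleR_le: "norm (psum (c *\<^sub>R x) (c *\<^sub>R y)) \<le> \<bar>c\<bar> * norm (psum x y)"
proof -
  have "norm (psum (c *\<^sub>R x) (c *\<^sub>R y)) powr p \<le> (\<Sum>i<Suc 0. norm (c *\<^sub>R psum x y) powr p)"
  proof (rule norm_powr_le_sum)
    fix \<delta> assume d: "\<delta> \<in> \<Delta>"
    show "AE a in M \<delta>. \<bar>spow p (rep (psum (c *\<^sub>R x) (c *\<^sub>R y)) \<delta> a)\<bar>
        \<le> (\<Sum>i<Suc 0. \<bar>spow p (rep (c *\<^sub>R psum x y) \<delta> a)\<bar>)"
      using AE_spow_psum[OF d, of x y] AE_spow_psum[OF d, of "c *\<^sub>R x" "c *\<^sub>R y"]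
        AE_spow_scaleR[OF d, of c x] AE_spow_scaleR[OF d, of c y]
        AE_spow_scaleR[OF d, of c "psum x y"]
      by eventually_elim (simp add: distrib_left)
  qed
  then have "norm (psum (c *\<^sub>R x) (c *\<^sub>R y)) powr p \<le> norm (c *\<^sub>R psum x y) powr p"
    by simp
  then have "norm (psum (c *\<^sub>R x) (c *\<^sub>R y)) \<le> norm (c *\<^sub>R psum x y)"
    using p_ge_1 powr_less_mono2[of p "norm (c *\<^sub>R psum x y)" "norm (psum (c *\<^sub>R x) (c *\<^sub>R y))"]
    by (meson norm_ge_zero not_le less_le_trans zero_less_one)
  then show ?thesis by simp
qed

lemma norm_psum_scaleR: "norm (psum (c *\<^sub>R x) (c *\<^sub>R y)) = \<bar>c\<bar> * norm (psum x y)"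
proof (cases "c = 0")
  case True
  then show ?thesis using norm_psum_scaleR_le[of c x y] by simp
next
  case False
  have "norm (psum x y) \<le> \<bar>1 / c\<bar> * norm (psum (c *\<^sub>R x) (c *\<^sub>R y))"
    using norm_psum_scaleR_le[of "1 / c" "c *\<^sub>R x" "c *\<^sub>R y"] False by simp
  then have "\<bar>c\<bar> * norm (psum x y) \<le> norm (psum (c *\<^sub>R x) (c *\<^sub>R y))"
    using False by (simp add: field_simps)
  with norm_psum_scaleR_le show ?thesis by (intro antisym)
qed

text \<open>The p-th power of the left p-sum is that of the right one plus multiples of the p-th
  powers of \<open>h\<close> and \<open>g\<close>. The vectors \<open>s *\<^sub>R h\<close> and
  \<open>t *\<^sub>R g\<close> carry these corrections, and p-convexity is applied to three
  summands.\<close>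

lemma norm_psum_change_scalars:
  assumes "0 \<le> a" "0 \<le> b" "0 \<le> a'" "0 \<le> b'"
  shows "norm (psum (a *\<^sub>R h) (b *\<^sub>R g)) powr p \<le> norm (psum (a' *\<^sub>R h) (b' *\<^sub>R g)) powr p
    + \<bar>a powr p - a' powr p\<bar> * norm h powr p + \<bar>b powr p - b' powr p\<bar> * norm g powr p"
proof -
  define s where "s = \<bar>a powr p - a' powr p\<bar> powr (1 / p)"
  define t where "t = \<bar>b powr p - b' powr p\<bar> powr (1 / p)"
  have s: "0 \<le> s" "s powr p = \<bar>a powr p - a' powr p\<bar>"
    and t: "0 \<le> t" "t powr p = \<bar>b powr p - b' powr p\<bar>"
    using p_ge_1 by (simp_all add: s_def t_def powr_powr)
  let ?u = "psum (a *\<^sub>R h) (b *\<^sub>R g)" and ?v = "psum (a' *\<^sub>R h) (b' *\<^sub>R g)"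
  let ?x = "\<lambda>i. if i = (0::nat) then ?v else if i = 1 then s *\<^sub>R h else t *\<^sub>R g"
  have "norm ?u powr p \<le> (\<Sum>i<3. norm (?x i) powr p)"
  proof (rule norm_powr_le_sum)
    fix \<delta> assume d: "\<delta> \<in> \<Delta>"
    have le: "\<bar>a powr p * H + b powr p * G\<bar>
        \<le> \<bar>a' powr p * H + b' powr p * G\<bar> + \<bar>s powr p * H\<bar> + \<bar>t powr p * G\<bar>" for H G
    proof -
      have "\<bar>s powr p * H\<bar> = \<bar>(a powr p - a' powr p) * H\<bar>"
          "\<bar>t powr p * G\<bar> = \<bar>(b powr p - b' powr p) * G\<bar>"
        by (simp_all add: s t abs_mult)
      moreover have "a powr p * H + b powr p * G = (a' powr p * H + b' powr p * G)
          + (a powr p - a' powr p) * H + (b powr p - b' powr p) * G"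
        by (simp add: algebra_simps)
      ultimately show ?thesis
        by linarith
    qed
    show "AE a in M \<delta>. \<bar>spow p (rep ?u \<delta> a)\<bar> \<le> (\<Sum>i<3. \<bar>spow p (rep (?x i) \<delta> a)\<bar>)"
      using AE_spow_psum[OF d, of "a *\<^sub>R h" "b *\<^sub>R g"] AE_spow_psum[OF d, of "a' *\<^sub>R h" "b' *\<^sub>R g"]
        AE_spow_scaleR[OF d, of a h] AE_spow_scaleR[OF d, of b g]
        AE_spow_scaleR[OF d, of a' h] AE_spow_scaleR[OF d, of b' g]
        AE_spow_scaleR[OF d, of s h] AE_spow_scaleR[OF d, of t g]
    proof eventually_elim
      case (elim \<alpha>)
      then show ?case
        using le[of "spow p (rep h \<delta> \<alpha>)" "spow p (rep g \<delta> \<alpha>)"] assms s(1) t(1)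
        by (simp add: numeral_3_eq_3 spow_nonneg)
    qed
  qed
  then show ?thesis
    using s t by (simp add: numeral_3_eq_3 powr_mult)
qed

section \<open>The p-Daugavet equation and the slice condition\<close>

lemma p_Daugavet_equation_psum:
  "p_Daugavet_equation p \<Delta> M rep T \<longleftrightarrow>
    (SUP f\<in>cball 0 1. norm (psum f (blinfun_apply T f))) = (1 + norm T powr p) powr (1 / p)"
  by (simp add: p_Daugavet_equation_def gnorm_psum)

text \<open>The half of the Daugavet equation that holds for every bounded operator. It also bounds
  the set whose supremum is taken.\<close>

lemma norm_psum_blinfun_le:
  assumes "f \<in> cball 0 1"
  shows "norm (psum f (blinfun_apply T f)) \<le> (1 + norm T powr p) powr (1 / p)"
proof -
  have f: "norm f \<le> 1"
    using assms by simp
  have "norm (blinfun_apply T f) \<le> norm T"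
    using norm_blinfun[of T f] mult_left_le[OF f norm_ge_zero[of T]] by linarith
  then have "norm (psum f (blinfun_apply T f)) powr p \<le> 1 powr p + norm T powr p"
    using f p_ge_1 by (intro order_trans[OF norm_psum_le] add_mono powr_mono2) auto
  then have "(norm (psum f (blinfun_apply T f)) powr p) powr (1 / p)
      \<le> (1 + norm T powr p) powr (1 / p)"
    using p_ge_1 by (intro powr_mono2) auto
  then show ?thesis
    using p_ge_1 by (simp add: powr_powr)
qed

text \<open>The equation is applied to the operator sending \<open>x\<close> to
  \<open>\<phi> x *\<^sub>R g\<close>; a nearly optimal vector, up to sign, is the required
  \<open>h\<close>.\<close>

lemma slice_if_p_Daugavet_property:
  assumes D: "p_Daugavet_property p \<Delta> M rep"
    and e: "\<epsilon> > 0" and g: "norm g = 1" and \<phi>: "norm \<phi> = 1"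
  shows "\<exists>h\<in>slice \<phi> \<epsilon>. norm (psum g h) powr p \<ge> 2 - 2 * \<epsilon>"
proof (cases "\<epsilon> < 1")
  \<comment> \<open>Here the zero vector lies in the slice and the required lower bound is at most
    0.\<close>
  case False
  then show ?thesis
    by (intro bexI[of _ 0]) (auto simp: slice_def intro: order_trans[of _ 0])
next
  case True
  obtain T where T: "\<And>x. blinfun_apply T x = blinfun_apply \<phi> x *\<^sub>R g" "norm T = 1"
      "dim (range (blinfun_apply T)) = 1"
    using rank_one_blinfun_exists[of \<phi> g] g \<phi> by force
  let ?N = "\<lambda>f. norm (psum f (blinfun_apply T f))"
  have S: "(SUP f\<in>cball 0 1. ?N f) = 2 powr (1 / p)"
    using D T(2,3) unfolding p_Daugavet_property_def p_Daugavet_equation_psum by simp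
  have bdd: "bdd_above (?N ` cball 0 1)"
    by (rule bdd_aboveI2) (rule norm_psum_blinfun_le)
  \<comment> \<open>One \<open>\<epsilon>\<close> is given up here; the other pays for replacing
    \<open>t *\<^sub>R g\<close> by \<open>g\<close>, which costs
    \<open>1 - t powr p \<le> \<epsilon>\<close>.\<close>
  have "(2 - \<epsilon>) powr (1 / p) < (SUP f\<in>cball 0 1. ?N f)"
    unfolding S using e True p_ge_1 by (intro powr_less_mono2) auto
  then obtain f where f: "f \<in> cball 0 1" "(2 - \<epsilon>) powr (1 / p) < ?N f"
    using less_cSUP_iff[OF _ bdd] by auto
  \<comment> \<open>The sign makes \<open>\<phi> h\<close> nonnegative and leaves the norm of the
    p-sum unchanged, since \<open>T\<close> is linear.\<close>
  define h where "h = (if 0 \<le> blinfun_apply \<phi> f then f else - f)"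
  define t where "t = blinfun_apply \<phi> h"
  have h: "norm h \<le> 1" "0 \<le> t"
    using f by (auto simp: h_def t_def blinfun.minus_right)
  have "?N h = ?N f"
    using norm_psum_scaleR[of "-1" f "blinfun_apply T f"] by (simp add: h_def blinfun.minus_right)
  then have "((2 - \<epsilon>) powr (1 / p)) powr p < ?N h powr p"
    using f p_ge_1 by (intro powr_less_mono2) auto
  then have N: "2 - \<epsilon> < norm (psum h (t *\<^sub>R g)) powr p"
    using True p_ge_1 by (simp add: powr_powr T t_def)
  have t1: "t \<le> 1"
    using norm_blinfun[of \<phi> h] h \<phi> by (simp add: t_def)
  have hp: "norm h powr p \<le> 1"
    using h p_ge_1 powr_mono2[of p "norm h" 1] by simp
  \<comment> \<open>Subadditivity gives \<open>2 - \<epsilon> < 1 + t powr p\<close>.\<close>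
  have tp: "1 - \<epsilon> \<le> t powr p"
    using N norm_psum_le[of h "t *\<^sub>R g"] hp g h by simp
  moreover have "t powr p \<le> t powr 1"
    using h t1 p_ge_1 by (intro powr_mono') auto
  ultimately have "1 - \<epsilon> \<le> t"
    using h by simp
  then have "h \<in> slice \<phi> \<epsilon>"
    using h by (simp add: slice_def t_def)
  moreover have "2 - 2 * \<epsilon> \<le> norm (psum g h) powr p"
  proof -
    have "t powr p \<le> 1"
      using h t1 p_ge_1 powr_mono2[of p t 1] by simp
    then have "norm (psum h (t *\<^sub>R g)) powr p \<le> norm (psum h g) powr p + (1 - t powr p)"
      using norm_psum_change_scalars[of 1 t 1 1 h g] h g by simp
    moreover have "psum h g = psum g h"
      by (simp add: psum_def add.commute)
    ultimately show ?thesis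
      using N tp by simp
  qed
  ultimately show ?thesis by blast
qed

text \<open>Only the lower bound for the supremum uses the slices: each \<open>h\<close> from a
  slice is tested in the equation, and then \<open>\<epsilon>\<close> tends to 0.\<close>

lemma p_Daugavet_property_if_slice:
  assumes S: "\<And>\<epsilon> g (\<phi> :: 'x \<Rightarrow>\<^sub>L real). \<epsilon> > 0 \<Longrightarrow> norm g = 1 \<Longrightarrow> norm \<phi> = 1 \<Longrightarrow>
    \<exists>h\<in>slice \<phi> \<epsilon>. norm (psum g h) powr p \<ge> 2 - 2 * \<epsilon>"
  shows "p_Daugavet_property p \<Delta> M rep"
  unfolding p_Daugavet_property_def p_Daugavet_equation_psum
proof (intro allI impI antisym)
  fix T :: "'x \<Rightarrow>\<^sub>L 'x"
  assume "dim (range (blinfun_apply T)) = 1"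
  then obtain \<phi> :: "'x \<Rightarrow>\<^sub>L real" and g :: 'x
    where \<phi>: "norm \<phi> = 1" and g: "norm g = 1" and c: "norm T > 0"
      and T: "\<And>x. blinfun_apply T x = (norm T * blinfun_apply \<phi> x) *\<^sub>R g"
    by (rule rank_one_blinfunE) blast
  let ?N = "\<lambda>f. norm (psum f (blinfun_apply T f))"
  let ?S = "SUP f\<in>cball 0 1. ?N f"
  show "?S \<le> (1 + norm T powr p) powr (1 / p)"
    by (rule cSUP_least) (auto intro!: norm_psum_blinfun_le)
  \<comment> \<open>Both scalars in the p-sum of \<open>h\<close> and \<open>t *\<^sub>R g\<close>
    are at most \<open>m\<close>, so passing to them from the common scalar \<open>m\<close> costs
    \<open>m powr p - 1\<close> and \<open>m powr p - t powr p\<close> at most.\<close>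
  define m where "m = max 1 (norm T)"
  have bdd: "bdd_above (?N ` cball 0 1)"
    by (rule bdd_aboveI2) (rule norm_psum_blinfun_le)
  \<comment> \<open>Needed for the p-th root to undo the p-th power at the end.\<close>
  have S0: "0 \<le> ?S"
    by (rule order_trans[OF norm_ge_zero cSUP_upper[OF _ bdd, of 0]]) simp
  have lower: "1 + norm T powr p * (1 - \<epsilon>) powr p - 2 * m powr p * \<epsilon> \<le> ?S powr p"
    if e: "0 < \<epsilon>" "\<epsilon> < 1" for \<epsilon>
  proof -
    obtain h where h: "norm h \<le> 1" "1 - \<epsilon> \<le> blinfun_apply \<phi> h"
        and N: "2 - 2 * \<epsilon> \<le> norm (psum g h) powr p"
      using S[OF e(1) g \<phi>] by (auto simp: slice_def)
    define t where "t = norm T * blinfun_apply \<phi> h"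
    have "blinfun_apply \<phi> h \<le> 1"
      using norm_blinfun[of \<phi> h] h \<phi> by simp
    then have "t \<le> norm T"
      unfolding t_def using c by (intro mult_left_le) auto
    then have tm: "t \<le> m"
      by (simp add: m_def)
    have t: "norm T * (1 - \<epsilon>) \<le> t" "0 \<le> t"
      using h c e by (auto simp: t_def)
    have m1: "1 \<le> m powr p" and tmp: "t powr p \<le> m powr p"
      and tp: "norm T powr p * (1 - \<epsilon>) powr p \<le> t powr p"
      using t tm p_ge_1 e powr_mono2[of p 1 m] powr_mono2[of p t m]
        powr_mono2[of p "norm T * (1 - \<epsilon>)" t] by (auto simp: m_def powr_mult)
    have hp: "norm h powr p \<le> 1"
      using h p_ge_1 powr_mono2[of p "norm h" 1] by simp
    have "psum h g = psum g h"
      by (simp add: psum_def add.commute)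
    \<comment> \<open>This quantity is at least \<open>m powr p * (2 - 2 * \<epsilon>)\<close>;
      subtracting both costs leaves \<open>1 + t powr p - 2 * m powr p * \<epsilon>\<close>.\<close>
    then have "norm (psum (m *\<^sub>R h) (m *\<^sub>R g)) powr p = m powr p * norm (psum g h) powr p"
      by (simp add: norm_psum_scaleR powr_mult m_def)
    moreover have "m powr p * (2 - 2 * \<epsilon>) \<le> m powr p * norm (psum g h) powr p"
      using N by (intro mult_left_mono) auto
    moreover have "norm (psum (m *\<^sub>R h) (m *\<^sub>R g)) powr p
        \<le> ?N h powr p + (m powr p - 1) * norm h powr p + (m powr p - t powr p)"
      using norm_psum_change_scalars[of m m 1 t h g] m1 tmp t g by (simp add: m_def T t_def)
    moreover have "(m powr p - 1) * norm h powr p \<le> m powr p - 1"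
      using m1 hp by (intro mult_left_le) auto
    moreover have "?N h powr p \<le> ?S powr p"
      using h p_ge_1 by (intro powr_mono2 cSUP_upper bdd) auto
    ultimately show ?thesis
      using tp by (simp add: algebra_simps)
  qed
  have "((\<lambda>\<epsilon>. 1 + norm T powr p * (1 - \<epsilon>) powr p - 2 * m powr p * \<epsilon>) \<longlongrightarrow>
      1 + norm T powr p * (1 - 0) powr p - 2 * m powr p * 0) (at_right 0)"
    by (intro tendsto_intros) auto
  then have "1 + norm T powr p * (1 - 0) powr p - 2 * m powr p * 0 \<le> ?S powr p"
    by (rule tendsto_upperbound)
      (auto intro!: lower eventually_at_rightI[of 0 1])
  then have "(1 + norm T powr p) powr (1 / p) \<le> (?S powr p) powr (1 / p)"
    using p_ge_1 by (intro powr_mono2) auto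
  then show "(1 + norm T powr p) powr (1 / p) \<le> ?S"
    using p_ge_1 S0 by (simp add: powr_powr)
qed

end

theorem corollary2p4:
  fixes p :: real
    and \<Delta> :: "'d set"
    and M :: "'d \<Rightarrow> 'a measure"
    and rep :: "'x::banach \<Rightarrow> 'd \<Rightarrow> 'a \<Rightarrow> real"
  assumes "1 \<le> p"
    and "gfs \<Delta> M rep"
    and "p_convex p \<Delta> M rep"
  shows "p_Daugavet_property p \<Delta> M rep \<longleftrightarrow>
    (\<forall>\<epsilon>>0. \<forall>g\<in>sphere 0 1. \<forall>g'\<in>sphere (0 :: 'x \<Rightarrow>\<^sub>L real) 1. \<exists>h\<in>slice g' \<epsilon>.
       gnorm \<Delta> M rep (\<lambda>\<delta> a. \<bar>spow p (rep g \<delta> a) + spow p (rep h \<delta> a)\<bar> powr (1 / p)) powr p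
         \<ge> 2 - 2 * \<epsilon>)"
proof -
  interpret gfs \<Delta> M rep
    by fact
  interpret p_convex_gfs \<Delta> M rep p
    by unfold_locales fact+
  show ?thesis
    unfolding gnorm_abs_psum
    using slice_if_p_Daugavet_property p_Daugavet_property_if_slice by auto
qed

end
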